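(* Let $C\subseteq\mathbb{R}^2$ be a homogenization-convex set and let $K\subseteq\mathbb{R}^2$ be a closed convex cone with nonempty interior such that $$\overline{\operatorname{cone}(C)\cap K}=\overline{\operatorname{cone}(C)}\cap K .$$ Then $$(C\cap K)^*=C^*+K^*.$$
   Context: Overlines denote topological closure in $\mathbb{R}^2$, and $\langle\cdot,\cdot\rangle$ is the standard inner product. For $C\subseteq\mathbb{R}^2$: $\hom(C)=\{\tau x:\tau\ge 0,\ x\in C\}$ is the homogeneous hull; $\operatorname{cone}(C)=\{\sum_{i=1}^n\lambda_i x_i: n\in\mathbb{N},\ \lambda_i\ge 0,\ x_i\in C\}$ is the conic hull; convention: $\hom(\emptyset)=\operatorname{cone}(\emptyset)=\{0\}$. The set $C$ is called homogenization-convex if $\overline{\hom(C)}$ is a convex subset of $\mathbb{R}^2$. A convex cone is a convex set that contains $0$ and is closed under multiplication by nonnegative scalars. The dual cone of an arbitrary subset $C\subseteq\mathbb{R}^2$ is $C^*=\{y\in\mathbb{R}^2:\langle x,y\rangle\ge 0\ \ \forall x\in C\}$ (so $\emptyset^*=\mathbb{R}^2$). The sum $C^*+K^*$ is the Minkowski sum. *)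

theory Defs
  imports "HOL-Analysis.Analysis"
begin

definition hom_hull :: "'a::real_vector set \<Rightarrow> 'a set" where
  "hom_hull C = (if C = {} then {0} else {\<tau> *\<^sub>R x |\<tau> x. \<tau> \<ge> 0 \<and> x \<in> C})"

(* The empty combination (n = 0) gives the convention cone {} = {0}.  The library's
   "conic hull" is the homogeneous hull above up to the empty set; its convex_cone hull is
   the notion defined here, see conical_hull_eq_convex_cone_hull. *)
definition conical_hull :: "'a::real_vector set \<Rightarrow> 'a set" where
  "conical_hull C =
     {\<Sum>i<n. l i *\<^sub>R x i |(n::nat) (l :: nat \<Rightarrow> real) x. \<forall>i<n. l i \<ge> 0 \<and> x i \<in> C}"

definition homogenization_convex :: "'a::real_normed_vector set \<Rightarrow> bool" where
  "homogenization_convex C \<longleftrightarrow> convex (closure (hom_hull C))"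

definition dual_cone :: "'a::real_inner set \<Rightarrow> 'a set" where
  "dual_cone C = {y. \<forall>x\<in>C. x \<bullet> y \<ge> 0}"

lemma hom_hull_eq_conic_hull: "C \<noteq> {} \<Longrightarrow> hom_hull C = conic hull C"
  by (simp add: hom_hull_def conic_hull_explicit)

lemma conical_hull_empty: "conical_hull {} = {0}"
proof -
  have "(\<Sum>i<0. l i *\<^sub>R x i) \<in> conical_hull ({} :: 'a set)"
    for l :: "nat \<Rightarrow> real" and x :: "nat \<Rightarrow> 'a"
    unfolding conical_hull_def by blast
  moreover have "n = 0" if "\<forall>i<n. l i \<ge> 0 \<and> x i \<in> {}"
    for n :: nat and l :: "nat \<Rightarrow> real" and x :: "nat \<Rightarrow> 'a"
    using that by (metis empty_iff neq0_conv)
  ultimately show ?thesis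
    by (fastforce simp: conical_hull_def)
qed

lemma conical_hull_eq_convex_cone_hull: "conical_hull C = convex_cone hull C"
proof
  have "(\<Sum>i<n. l i *\<^sub>R x i) \<in> convex_cone hull C" if "\<forall>i<n. l i \<ge> 0 \<and> x i \<in> C"
    for n :: nat and l :: "nat \<Rightarrow> real" and x :: "nat \<Rightarrow> 'a"
    using that
  proof (induction n)
    case 0
    then show ?case by (simp add: convex_cone_hull_contains_0)
  next
    case (Suc n)
    have "x n \<in> convex_cone hull C" using Suc.prems by (simp add: hull_inc)
    then show ?case using Suc by (simp add: convex_cone_hull_add convex_cone_hull_mul)
  qed
  then show "conical_hull C \<subseteq> convex_cone hull C"
    by (auto simp: conical_hull_def)
next
  have z: "0 \<in> conical_hull C"
    unfolding conical_hull_def by (rule CollectI, rule exI[of _ 0]) auto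
  have s: "c *\<^sub>R v \<in> conical_hull C" if v: "v \<in> conical_hull C" and c: "c \<ge> 0" for c v
  proof -
    obtain n :: nat and l x where lx: "v = (\<Sum>i<n. l i *\<^sub>R x i)" "\<forall>i<n. l i \<ge> 0 \<and> x i \<in> C"
      using v unfolding conical_hull_def by auto
    have "c *\<^sub>R v = (\<Sum>i<n. (c * l i) *\<^sub>R x i)"
      by (simp add: lx scaleR_sum_right)
    moreover have "\<forall>i<n. c * l i \<ge> 0 \<and> x i \<in> C" using lx c by simp
    ultimately show ?thesis
      unfolding conical_hull_def
      by (intro CollectI exI[of _ n] exI[of _ "\<lambda>i. c * l i"] exI[of _ x]) auto
  qed
  have a: "v + w \<in> conical_hull C" if v: "v \<in> conical_hull C" and w: "w \<in> conical_hull C" for v w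
  proof -
    obtain n :: nat and l x where lx: "v = (\<Sum>i<n. l i *\<^sub>R x i)" "\<forall>i<n. l i \<ge> 0 \<and> x i \<in> C"
      using v unfolding conical_hull_def by auto
    obtain m :: nat and k y where ky: "w = (\<Sum>i<m. k i *\<^sub>R y i)" "\<forall>i<m. k i \<ge> 0 \<and> y i \<in> C"
      using w unfolding conical_hull_def by auto
    let ?l = "\<lambda>i. if i < n then l i else k (i - n)"
    let ?x = "\<lambda>i. if i < n then x i else y (i - n)"
    have "(\<Sum>i<n + j. ?l i *\<^sub>R ?x i) = (\<Sum>i<n. l i *\<^sub>R x i) + (\<Sum>i<j. k i *\<^sub>R y i)" for j
      by (induction j) (simp_all add: add.assoc)
    then have "v + w = (\<Sum>i<n + m. ?l i *\<^sub>R ?x i)"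
      using lx(1) ky(1) by simp
    moreover have "\<forall>i<n + m. ?l i \<ge> 0 \<and> ?x i \<in> C"
      using lx ky by auto
    ultimately show ?thesis
      unfolding conical_hull_def
      by (intro CollectI exI[of _ "n + m"] exI[of _ ?l] exI[of _ ?x]) simp
  qed
  have "convex_cone (conical_hull C)"
    using z s a by (simp add: convex_cone_iff)
  moreover have "C \<subseteq> conical_hull C"
  proof
    fix v assume "v \<in> C"
    then show "v \<in> conical_hull C"
      unfolding conical_hull_def
      by (intro CollectI exI[of _ 1] exI[of _ "\<lambda>_. 1"] exI[of _ "\<lambda>_. v"]) simp
  qed
  ultimately show "convex_cone hull C \<subseteq> conical_hull C"
    by (simp add: hull_minimal)
qed

end

theory Submission
  imports Defs
begin

text \<open>
  Put \<open>L = closure (conical_hull C)\<close>, which equals \<open>closure (hom_hull C)\<close>. In the plane the sum of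
  two closed convex cones is closed, so separation gives
  \<open>dual_cone (L \<inter> K) = dual_cone C + dual_cone K\<close>, and it remains to see that a functional
  nonnegative on \<open>C \<inter> K\<close> is nonnegative on \<open>L \<inter> K\<close>. If \<open>L\<close> meets the interior of \<open>K\<close>, this
  follows from the density of \<open>hom_hull C\<close> in \<open>L\<close>. Otherwise a line through the origin separates \<open>L\<close>
  from \<open>K\<close> and contains \<open>L \<inter> K\<close>. A point of \<open>conical_hull C \<inter> K\<close> is then a conic combination of
  points of \<open>C\<close> on that line, so by the hypothesis on the closures every ray of \<open>L \<inter> K\<close> contains a
  point of \<open>C\<close>.
\<close>

section \<open>Dual cones, separation and the bipolar theorem\<close>

lemma closed_dual_cone: "closed (dual_cone C)"
proof -
  have "dual_cone C = (\<Inter>x\<in>C. {y. 0 \<le> x \<bullet> y})"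
    by (auto simp: dual_cone_def)
  then show ?thesis
    by (simp add: closed_INT closed_halfspace_ge)
qed

lemma convex_cone_dual_cone: "convex_cone (dual_cone C)"
  by (auto simp: convex_cone_iff dual_cone_def inner_add_right)

lemma convex_cone_closure:
  fixes S :: "'a::euclidean_space set"
  assumes "convex_cone S" shows "convex_cone (closure S)"
  using assms by (simp add: convex_cone_def convex_closure conic_closure)

lemma convex_cone_set_plus:
  assumes "convex_cone A" "convex_cone B" shows "convex_cone (A + B)"
proof -
  have "A + B = (\<Union>x\<in>A. \<Union>y\<in>B. {x + y})"
    by (auto simp: set_plus_def)
  then show ?thesis
    using convex_cone_sums[OF assms] by simp
qed

lemma separate_point_from_closed_convex_cone:
  fixes S :: "'a::euclidean_space set"
  assumes "closed S" "convex_cone S" "w \<notin> S"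
  obtains z where "z \<bullet> w < 0" "z \<in> dual_cone S"
proof -
  obtain z b where zb: "z \<bullet> w < b" "\<And>x. x \<in> S \<Longrightarrow> b < z \<bullet> x"
    using separating_hyperplane_closed_point[of S w] assms unfolding convex_cone_def by blast
  have "b < 0"
    using zb(2)[OF convex_cone_contains_0[OF assms(2)]] by simp
  have "0 \<le> z \<bullet> x" if "x \<in> S" for x
  proof (rule ccontr)
    assume neg: "\<not> 0 \<le> z \<bullet> x"
    \<comment> \<open>Rescaling \<open>x\<close> to the point where \<open>z\<close> takes exactly
      the value \<open>b\<close> uses a positive factor and so stays in \<open>S\<close>, against
      the strictness of the separation.\<close>
    have "b < z \<bullet> ((b / (z \<bullet> x)) *\<^sub>R x)"
      using neg \<open>b < 0\<close> that assms(2)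
      by (intro zb(2) convex_cone_scaleR) (auto simp: divide_nonpos_neg)
    then show False using neg by simp
  qed
  then show thesis
    using zb(1) \<open>b < 0\<close> by (intro that) (auto simp: dual_cone_def inner_commute)
qed

text \<open>The bipolar theorem for cones: a point outside \<open>S\<close> is cut off by an element
  of \<open>dual_cone S\<close>.\<close>

lemma dual_cone_dual_cone:
  fixes S :: "'a::euclidean_space set"
  assumes "closed S" "convex_cone S"
  shows "dual_cone (dual_cone S) = S"
proof
  show "S \<subseteq> dual_cone (dual_cone S)"
    by (auto simp: dual_cone_def inner_commute)
  show "dual_cone (dual_cone S) \<subseteq> S"
  proof
    fix w assume w: "w \<in> dual_cone (dual_cone S)"
    show "w \<in> S"
    proof (rule ccontr)
      assume "w \<notin> S"
      then obtain z where "z \<bullet> w < 0" "z \<in> dual_cone S"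
        using separate_point_from_closed_convex_cone assms by blast
      with w show False
        by (force simp: dual_cone_def[of "dual_cone S"])
    qed
  qed
qed

section \<open>Closed sums of cones and the dual of an intersection\<close>

text \<open>The sum is the conic hull of the sums \<open>a + b\<close> with \<open>(a, b)\<close> on the unit sphere of the product.\<close>

lemma closed_set_plus_cones:
  fixes A B :: "'a::euclidean_space set"
  assumes A: "closed A" "convex_cone A" and B: "closed B" "convex_cone B"
    and pointed: "\<And>u. u \<in> A \<Longrightarrow> - u \<in> B \<Longrightarrow> u = 0"
  shows "closed (A + B)"
proof -
  define S where "S = (\<lambda>p. fst p + snd p) ` ((A \<times> B) \<inter> sphere 0 1)"
  have "compact ((A \<times> B) \<inter> sphere 0 1)"
    using A B by (intro closed_Int_compact closed_Times) auto
  then have "compact S"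
    unfolding S_def by (intro compact_continuous_image continuous_intros)
  moreover have "0 \<notin> S"
  proof
    assume "0 \<in> S"
    then obtain a b where ab: "a \<in> A" "b \<in> B" "norm (a, b) = 1" "a + b = 0"
      by (auto simp: S_def)
    then have "b = - a" by (simp add: add_eq_0_iff)
    with ab pointed[of a] show False by (auto simp: norm_Pair)
  qed
  ultimately have "closed (conic hull S)"
    by (simp add: closed_conic_hull)
  \<comment> \<open>\<open>insert 0\<close> covers \<open>A = B = {0}\<close>, where
    \<open>S\<close> and with it the conic hull are empty.\<close>
  moreover have "A + B = insert 0 (conic hull S)"
  proof
    show "A + B \<subseteq> insert 0 (conic hull S)"
    proof
      fix w assume "w \<in> A + B"
      then obtain a b where ab: "a \<in> A" "b \<in> B" "w = a + b"
        by (auto simp: set_plus_def)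
      show "w \<in> insert 0 (conic hull S)"
      proof (cases "(a, b) = 0")
        case True
        with ab show ?thesis by (simp add: zero_prod_def)
      next
        case False
        define r where "r = norm (a, b)"
        have r: "r > 0" using False by (simp add: r_def)
        have "norm ((1 / r) *\<^sub>R (a, b)) = 1"
          using r unfolding norm_scaleR by (simp add: r_def)
        then have "(1 / r) *\<^sub>R a + (1 / r) *\<^sub>R b \<in> S"
          unfolding S_def using ab A B r
          by (intro image_eqI[of _ _ "(1 / r) *\<^sub>R (a, b)"]) (auto intro: convex_cone_scaleR)
        moreover have "w = r *\<^sub>R ((1 / r) *\<^sub>R a + (1 / r) *\<^sub>R b)"
          using r ab by (simp add: scaleR_add_right)
        ultimately show ?thesis
          unfolding conic_hull_explicit using r by (auto intro!: less_imp_le)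
      qed
    qed
    have AB: "convex_cone (A + B)" by (rule convex_cone_set_plus[OF A(2) B(2)])
    have "S \<subseteq> A + B" by (auto simp: S_def)
    then have "conic hull S \<subseteq> A + B"
      using AB by (simp add: hull_minimal convex_cone_def)
    then show "insert 0 (conic hull S) \<subseteq> A + B"
      using convex_cone_contains_0[OF AB] by simp
  qed
  ultimately show ?thesis by simp
qed

text \<open>The orthogonal complement of \<open>v\<close> is a line, so \<open>x\<close> is its own
  projection onto \<open>m\<close>. Clearing the denominator admits \<open>m = 0\<close>.\<close>

lemma orthogonal_same_vector_real2:
  fixes v x m :: "real^2"
  assumes "v \<noteq> 0" "v \<bullet> x = 0" "v \<bullet> m = 0"
  shows "(m \<bullet> m) *\<^sub>R x = (x \<bullet> m) *\<^sub>R m"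
proof -
  have 1: "v$1 * x$1 + v$2 * x$2 = 0" and 2: "v$1 * m$1 + v$2 * m$2 = 0"
    using assms by (simp_all add: inner_vec_def sum_2)
  have "v$1 * (x$1 * m$2 - x$2 * m$1) = 0" "v$2 * (x$1 * m$2 - x$2 * m$1) = 0"
    using 1 2 by algebra+
  moreover have "v$1 \<noteq> 0 \<or> v$2 \<noteq> 0"
    using assms(1) by (auto simp: vec_eq_iff forall_2)
  ultimately have "x$1 * m$2 = x$2 * m$1" by auto
  then show ?thesis
    by (simp add: vec_eq_iff forall_2 inner_vec_def sum_2) algebra
qed

lemma orthogonal_vector_real2:
  fixes u :: "real^2"
  assumes "u \<noteq> 0"
  obtains v :: "real^2" where "v \<noteq> 0" "v \<bullet> u = 0"
proof
  let ?v = "vector [- u$2, u$1] :: real^2"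
  have "?v$1 = - u$2" "?v$2 = u$1" by simp_all
  moreover have "u$1 \<noteq> 0 \<or> u$2 \<noteq> 0"
    using assms by (simp add: vec_eq_iff forall_2)
  ultimately show "?v \<noteq> 0" by (metis neg_equal_0_iff_equal zero_index)
  show "?v \<bullet> u = 0" by (simp add: inner_vec_def sum_2)
qed

text \<open>Such a cone is a line, a closed half-plane or the plane. Instead of splitting into these
  cases, a limit point \<open>w\<close> off the line through \<open>u\<close> is compared with a
  point \<open>w'\<close> of \<open>S\<close> strictly on the same side: some positive multiple of
  \<open>w'\<close> differs from \<open>w\<close> by a vector of the line.\<close>

lemma closed_convex_cone_real2_if_contains_line:
  fixes S :: "(real^2) set"
  assumes S: "convex_cone S" and u: "u \<in> S" "- u \<in> S" "u \<noteq> 0"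
  shows "closed S"
proof -
  obtain v where v: "v \<noteq> 0" "v \<bullet> u = 0"
    using orthogonal_vector_real2 u(3) by blast
  have line: "x \<in> S" if "v \<bullet> x = 0" for x
  proof -
    define c where "c = (x \<bullet> u) / (u \<bullet> u)"
    have "(u \<bullet> u) *\<^sub>R x = (x \<bullet> u) *\<^sub>R u"
      using orthogonal_same_vector_real2 v that by blast
    then have "(1 / (u \<bullet> u)) *\<^sub>R (u \<bullet> u) *\<^sub>R x = (1 / (u \<bullet> u)) *\<^sub>R (x \<bullet> u) *\<^sub>R u"
      by simp
    then have x: "x = c *\<^sub>R u" using u(3) by (simp add: c_def)
    show ?thesis
    proof (cases "0 \<le> c")
      case True
      then show ?thesis using x S u by (auto intro: convex_cone_scaleR)
    next
      case False
      then have "(- c) *\<^sub>R (- u) \<in> S" using S u by (intro convex_cone_scaleR) auto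
      then show ?thesis using x by simp
    qed
  qed
  have "w \<in> S" if w: "w \<in> closure S" for w
  proof (cases "v \<bullet> w = 0")
    case False
    define U where "U = {x. 0 < ((v \<bullet> w) *\<^sub>R v) \<bullet> x}"
    have "open U" unfolding U_def by (rule open_halfspace_gt)
    moreover have "w \<in> U" using False by (auto simp: U_def zero_less_mult_iff linorder_neq_iff)
    ultimately obtain w' where w': "w' \<in> S" "0 < (v \<bullet> w) * (v \<bullet> w')"
      using open_Int_closure_eq_empty[of U S] w by (auto simp: U_def)
    define t where "t = (v \<bullet> w) / (v \<bullet> w')"
    have "t \<ge> 0" "v \<bullet> (w - t *\<^sub>R w') = 0"
      using w'(2) by (auto simp: t_def inner_diff_right zero_less_mult_iff zero_le_divide_iff)
    then have "(w - t *\<^sub>R w') + t *\<^sub>R w' \<in> S"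
      using w' S line by (intro convex_cone_add convex_cone_scaleR) auto
    then show ?thesis by simp
  qed (rule line)
  then show ?thesis by (metis closure_closed closure_subset closed_closure subsetI subset_antisym)
qed

text \<open>If the pointedness condition of \<open>closed_set_plus_cones\<close> fails at
  \<open>u\<close>, then both \<open>u\<close> and \<open>- u\<close> lie in the sum, which
  therefore contains a line.\<close>

lemma closed_set_plus_cones_real2:
  fixes A B :: "(real^2) set"
  assumes A: "closed A" "convex_cone A" and B: "closed B" "convex_cone B"
  shows "closed (A + B)"
proof (cases "\<exists>u. u \<in> A \<and> - u \<in> B \<and> u \<noteq> 0")
  case True
  then obtain u where u: "u \<in> A" "- u \<in> B" "u \<noteq> 0" by blast
  have "u + 0 \<in> A + B" "0 + - u \<in> A + B"
    using u A B by (blast intro: convex_cone_contains_0)+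
  then show ?thesis
    using closed_convex_cone_real2_if_contains_line[of "A + B" u] u
      convex_cone_set_plus[OF A(2) B(2)] by simp
next
  case False
  then show ?thesis using closed_set_plus_cones[OF assms] by blast
qed

text \<open>The right-hand side is a closed convex cone, so any other \<open>y\<close> is negative
  on some \<open>z\<close> in its dual. As the sum contains both summands, the bipolar theorem puts
  \<open>z\<close> in \<open>L\<close> and in \<open>K\<close>.\<close>

lemma dual_cone_Int_real2:
  fixes L K :: "(real^2) set"
  assumes L: "closed L" "convex_cone L" and K: "closed K" "convex_cone K"
  shows "dual_cone (L \<inter> K) \<subseteq> dual_cone L + dual_cone K"
proof
  fix y assume y: "y \<in> dual_cone (L \<inter> K)"
  let ?S = "dual_cone L + dual_cone K"
  show "y \<in> ?S"
  proof (rule ccontr)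
    assume "y \<notin> ?S"
    then obtain z where z: "z \<bullet> y < 0" "z \<in> dual_cone ?S"
      using separate_point_from_closed_convex_cone[of ?S y] closed_set_plus_cones_real2
        convex_cone_set_plus closed_dual_cone convex_cone_dual_cone by metis
    have 0: "0 \<in> dual_cone L" "0 \<in> dual_cone K"
      by (simp_all add: convex_cone_contains_0 convex_cone_dual_cone)
    have "dual_cone L \<subseteq> ?S" "dual_cone K \<subseteq> ?S"
      using set_plus_intro[OF _ 0(2)] set_plus_intro[OF 0(1)] by force+
    then have "z \<in> dual_cone (dual_cone L)" "z \<in> dual_cone (dual_cone K)"
      using z(2) by (auto simp: dual_cone_def[of ?S] dual_cone_def[of "dual_cone _"])
    then have "z \<in> L \<inter> K" using dual_cone_dual_cone L K by blast
    then show False using y z(1) by (force simp: dual_cone_def)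
  qed
qed

section \<open>Passage from \<open>C\<close> to its closed conical hull\<close>

text \<open>Homogenization-convexity turns the closure of the homogeneous hull into a convex cone
  containing \<open>C\<close>, which then absorbs all conic combinations.\<close>

lemma closure_hom_hull_eq_closure_conical_hull:
  fixes C :: "'a::euclidean_space set"
  assumes "homogenization_convex C"
  shows "closure (hom_hull C) = closure (conical_hull C)"
proof (cases "C = {}")
  case True
  then show ?thesis by (simp add: hom_hull_def conical_hull_empty)
next
  case False
  then have H: "hom_hull C = conic hull C" by (rule hom_hull_eq_conic_hull)
  have "convex_cone (closure (conic hull C))"
    using assms False H hull_subset[of C conic]
    by (auto simp: homogenization_convex_def convex_cone_def conic_closure conic_conic_hull)
  moreover have "C \<subseteq> closure (conic hull C)"
    using hull_subset closure_subset by fast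
  ultimately have "convex_cone hull C \<subseteq> closure (conic hull C)"
    by (simp add: hull_minimal)
  moreover have "conic hull C \<subseteq> convex_cone hull C"
    using convex_cone_convex_cone_hull[of C] by (intro hull_minimal hull_subset) (simp add: convex_cone_def)
  ultimately show ?thesis
    unfolding H conical_hull_eq_convex_cone_hull
    by (intro antisym closure_mono closure_minimal) auto
qed

text \<open>A point \<open>z\<close> where \<open>y\<close> is negative can be pushed slightly
  towards an interior point of \<open>K\<close>. Near the resulting \<open>q\<close>, density gives
  a point of \<open>hom_hull C\<close> that is still in \<open>K\<close> and negative under
  \<open>y\<close>; its ray contains a point of \<open>C\<close>.\<close>

lemma dual_cone_Int_closure_meeting_interior:
  fixes C K :: "'a::euclidean_space set"
  assumes K: "convex_cone K" and L: "convex (closure (hom_hull C))"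
    and meet: "closure (hom_hull C) \<inter> interior K \<noteq> {}"
    and y: "y \<in> dual_cone (C \<inter> K)"
  shows "y \<in> dual_cone (closure (hom_hull C) \<inter> K)"
proof (rule ccontr)
  let ?L = "closure (hom_hull C)"
  assume "y \<notin> dual_cone (?L \<inter> K)"
  then obtain z where z: "z \<in> ?L" "z \<in> K" "z \<bullet> y < 0"
    by (auto simp: dual_cone_def)
  obtain z' where z': "z' \<in> ?L" "z' \<in> interior K" using meet by blast
  define a where "a = - (z \<bullet> y)"
  define b where "b = \<bar>z' \<bullet> y\<bar>"
  \<comment> \<open>Chosen so that \<open>e * (a + b) = a / 2\<close>: the move from
    \<open>z\<close> to \<open>q\<close> then raises the value of \<open>y\<close> from
    \<open>- a\<close> to at most \<open>- a / 2\<close>.\<close>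
  define e where "e = a / (2 * (a + b))"
  have ab: "a > 0" "b \<ge> 0" using z by (auto simp: a_def b_def)
  then have e: "0 < e" "e \<le> 1" by (auto simp: e_def field_simps)
  have "e * (a + b) = a / 2" using ab by (simp add: e_def field_simps)
  define q where "q = z - e *\<^sub>R (z - z')"
  have "q \<bullet> y = - a + e * a + e * (z' \<bullet> y)"
    by (simp add: q_def a_def inner_diff_left algebra_simps)
  also have "\<dots> \<le> - a + e * (a + b)"
    using e mult_left_mono[of "z' \<bullet> y" b e] by (simp add: b_def distrib_left)
  also have "\<dots> < 0" using \<open>e * (a + b) = a / 2\<close> ab by simp
  finally have "q \<bullet> y < 0" .
  moreover have "q \<in> interior K"
    unfolding q_def using K z z' e by (intro mem_interior_convex_shrink) (auto simp: convex_cone_def)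
  moreover have "q \<in> ?L"
  proof -
    have "q = (1 - e) *\<^sub>R z + e *\<^sub>R z'" by (simp add: q_def algebra_simps)
    then show ?thesis using L z z' e by (simp add: convexD)
  qed
  moreover have "open (interior K \<inter> {x. y \<bullet> x < 0})"
    by (intro open_Int open_interior open_halfspace_lt)
  ultimately obtain h where h: "h \<in> hom_hull C" "h \<in> interior K" "y \<bullet> h < 0"
    using open_Int_closure_eq_empty[of "interior K \<inter> {x. y \<bullet> x < 0}" "hom_hull C"]
    by (auto simp: inner_commute)
  then have "C \<noteq> {}" by (auto simp: hom_hull_def)
  then obtain t x where x: "h = t *\<^sub>R x" "t \<ge> 0" "x \<in> C"
    using h(1) by (auto simp: hom_hull_def)
  then have t: "t > 0" using h(3) by (cases "t = 0") auto
  have "(1 / t) *\<^sub>R h \<in> K"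
    using h(2) interior_subset K t by (intro convex_cone_scaleR) auto
  then have "x \<in> K" using x t by simp
  then have "0 \<le> x \<bullet> y" using y x by (simp add: dual_cone_def)
  then show False using h(3) x t by (simp add: inner_commute mult_less_0_iff)
qed

text \<open>No cancellation is possible in the direction \<open>v\<close>, so every point used with
  positive weight lies on the line orthogonal to \<open>v\<close>. Pairing the combination with
  \<open>m\<close> finds one of them on the same side of the origin as \<open>m\<close>.\<close>

lemma ray_of_conical_hull_on_supporting_line:
  fixes C :: "(real^2) set"
  assumes v: "v \<noteq> 0" "\<And>x. x \<in> C \<Longrightarrow> 0 \<le> v \<bullet> x"
    and m: "m \<in> conical_hull C" "v \<bullet> m = 0" "m \<noteq> 0"
  obtains x c where "x \<in> C" "c > 0" "x = c *\<^sub>R m"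
proof -
  obtain n :: nat and l x where lx: "m = (\<Sum>i<n. l i *\<^sub>R x i)" "\<And>i. i < n \<Longrightarrow> l i \<ge> 0 \<and> x i \<in> C"
    using m(1) unfolding conical_hull_def by auto
  have "(\<Sum>i<n. l i * (v \<bullet> x i)) = 0"
    using m(2) by (simp add: lx(1) inner_sum_right)
  then have v0: "l i * (v \<bullet> x i) = 0" if "i < n" for i
    using that lx(2) v(2) by (subst (asm) sum_nonneg_eq_0_iff) auto
  have "(\<Sum>i<n. l i * (x i \<bullet> m)) = m \<bullet> m"
    by (subst (2) lx(1)) (simp add: inner_sum_left)
  then have "\<not> (\<Sum>i<n. l i * (x i \<bullet> m)) \<le> 0"
    using m(3) inner_gt_zero_iff[of m] by linarith
  then obtain i where i: "i < n" "0 < l i * (x i \<bullet> m)"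
    using sum_nonpos[of "{..<n}" "\<lambda>i. l i * (x i \<bullet> m)"] by force
  then have pos: "0 < l i" "0 < x i \<bullet> m"
    using lx(2)[of i] by (auto simp: zero_less_mult_iff)
  define c where "c = (x i \<bullet> m) / (m \<bullet> m)"
  have "v \<bullet> x i = 0" using v0[OF i(1)] pos by simp
  then have "(m \<bullet> m) *\<^sub>R x i = (x i \<bullet> m) *\<^sub>R m"
    using orthogonal_same_vector_real2 v(1) m(2) by blast
  then have "(1 / (m \<bullet> m)) *\<^sub>R (m \<bullet> m) *\<^sub>R x i = (1 / (m \<bullet> m)) *\<^sub>R (x i \<bullet> m) *\<^sub>R m"
    by simp
  then have "x i = c *\<^sub>R m" using m(3) by (simp add: c_def)
  moreover have "c > 0" using pos m(3) by (simp add: c_def)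
  ultimately show thesis using that lx(2) i(1) by blast
qed

lemma dual_cone_Int_closure_avoiding_interior:
  fixes C K :: "(real^2) set"
  assumes K: "closed K" "convex_cone K" "interior K \<noteq> {}"
    and clos: "closure (conical_hull C \<inter> K) = closure (conical_hull C) \<inter> K"
    and disj: "closure (conical_hull C) \<inter> interior K = {}"
    and y: "y \<in> dual_cone (C \<inter> K)"
  shows "y \<in> dual_cone (closure (conical_hull C) \<inter> K)"
proof (rule ccontr)
  let ?L = "closure (conical_hull C)"
  assume "y \<notin> dual_cone (?L \<inter> K)"
  then obtain z where z: "z \<in> ?L" "z \<in> K" "z \<bullet> y < 0"
    by (auto simp: dual_cone_def)
  have L: "convex_cone ?L"
    unfolding conical_hull_eq_convex_cone_hull
    by (intro convex_cone_closure convex_cone_convex_cone_hull)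
  have cK: "convex K" using K(2) by (simp add: convex_cone_def)
  have "convex ?L" "?L \<noteq> {}" using L by (simp_all add: convex_cone_def)
  then obtain w b where w: "w \<noteq> 0"
      "\<And>x. x \<in> ?L \<Longrightarrow> w \<bullet> x \<le> b" "\<And>x. x \<in> interior K \<Longrightarrow> b \<le> w \<bullet> x"
    using separating_hyperplane_sets[OF _ convex_interior[OF cK] _ K(3) disj] by blast
  \<comment> \<open>The separation concerns \<open>interior K\<close> only; it extends to
    \<open>K\<close>, the closure of its interior.\<close>
  have "closure (interior K) \<subseteq> {x. b \<le> w \<bullet> x}"
    using w(3) by (intro closure_minimal closed_halfspace_ge) auto
  then have wK: "b \<le> w \<bullet> x" if "x \<in> K" for x
    using that convex_closure_interior[OF cK K(3)] K(1) by auto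
  have b: "b = 0"
    using w(2)[OF convex_cone_contains_0[OF L]] wK[OF convex_cone_contains_0[OF K(2)]] by simp
  \<comment> \<open>Density of \<open>conical_hull C\<close> in \<open>?L\<close> alone could give
    approximating points outside \<open>K\<close>; \<open>clos\<close> keeps them in
    \<open>K\<close>.\<close>
  have "z \<in> closure (conical_hull C \<inter> K)" using z clos by simp
  moreover have "open {x. y \<bullet> x < 0}" by (rule open_halfspace_lt)
  ultimately obtain m where m: "m \<in> conical_hull C" "m \<in> K" "m \<bullet> y < 0"
    using open_Int_closure_eq_empty[of "{x. y \<bullet> x < 0}" "conical_hull C \<inter> K"] z
    by (auto simp: inner_commute)
  have "C \<subseteq> ?L"
    unfolding conical_hull_eq_convex_cone_hull using hull_subset closure_subset by fast
  moreover have "m \<in> ?L" using m(1) closure_subset by blast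
  \<comment> \<open>The point \<open>m\<close> belongs to both separated cones, hence to the
    separating line. The sign of \<open>w\<close> is switched to put \<open>C\<close> on the
    nonnegative side.\<close>
  ultimately have "- w \<bullet> m = 0" "\<And>x. x \<in> C \<Longrightarrow> 0 \<le> - w \<bullet> x"
    using w(2) wK[OF m(2)] b by force+
  then obtain x c where x: "x \<in> C" "c > 0" "x = c *\<^sub>R m"
    using ray_of_conical_hull_on_supporting_line[of "- w" C m] w(1) m by force
  then have "x \<in> K" using m K by (auto intro: convex_cone_scaleR)
  then have "0 \<le> x \<bullet> y" using y x(1) by (simp add: dual_cone_def)
  then show False using m(3) x by (simp add: zero_le_mult_iff)
qed

theorem theorem2p7:
  fixes C K :: "(real^2) set"
  assumes "homogenization_convex C"
    and "closed K" and "convex_cone K" and "interior K \<noteq> {}"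
    and "closure (conical_hull C \<inter> K) = closure (conical_hull C) \<inter> K"
  shows "dual_cone (C \<inter> K) = dual_cone C + dual_cone K"
proof
  show "dual_cone C + dual_cone K \<subseteq> dual_cone (C \<inter> K)"
    by (auto simp: dual_cone_def set_plus_def inner_add_right)
next
  let ?L = "closure (conical_hull C)"
  have eq: "closure (hom_hull C) = ?L"
    by (rule closure_hom_hull_eq_closure_conical_hull[OF assms(1)])
  have L: "convex_cone ?L"
    unfolding conical_hull_eq_convex_cone_hull
    by (intro convex_cone_closure convex_cone_convex_cone_hull)
  have CL: "C \<subseteq> ?L"
    unfolding conical_hull_eq_convex_cone_hull using hull_subset closure_subset by fast
  have "dual_cone (C \<inter> K) \<subseteq> dual_cone (?L \<inter> K)"
  proof (cases "?L \<inter> interior K = {}")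
    case True
    then show ?thesis
      using dual_cone_Int_closure_avoiding_interior[OF assms(2-5)] by blast
  next
    case False
    moreover have "convex ?L" using L by (simp add: convex_cone_def)
    ultimately show ?thesis
      using dual_cone_Int_closure_meeting_interior[OF assms(3), of C] unfolding eq by blast
  qed
  also have "\<dots> \<subseteq> dual_cone ?L + dual_cone K"
    using dual_cone_Int_real2 L assms(2,3) by simp
  also have "\<dots> \<subseteq> dual_cone C + dual_cone K"
    using CL by (intro set_plus_mono2) (auto simp: dual_cone_def)
  finally show "dual_cone (C \<inter> K) \<subseteq> dual_cone C + dual_cone K" .
qed

end
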